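(* Let $F_r$ be the free group of finite rank $r>1$ with a fixed free basis, $H$ a subgroup of $F_r$, and $\mathcal{G}$ the Cayley graph of the right action of $F_r$ on the set $F_r/H$ of right cosets of $H$. If the growth of $\mathcal{G}$ (i.e. of the $F_r$-set $F_r/H$) is maximal, then for any fixed maximal geodesic subtree $\mathcal{T}$ in $\mathcal{G}$ the measure $\mu(Y(\mathcal{T}))$ of the subset $Y(\mathcal{T})\subset\partial F_r$ is positive. Conversely, if there is a maximal geodesic subtree $\mathcal{T}$ in $\mathcal{G}$ such that $\mu(Y(\mathcal{T}))>0$, then the growth of $\mathcal{G}$ is maximal.
   Context: Let $B=A\cup A^{-1}$, where $A=\{a_1,\ldots,a_r\}$ is the fixed free basis. The Cayley graph $\mathcal{G}$ of the action has vertex set $F_r/H$ (right cosets $Hg$), distinguished vertex $o=H$, and for each vertex $s$ and $a\in B$ exactly one directed edge with source $s$, target $sa$ and label $a$; the edge from $sa$ to $s$ with label $a^{-1}$ is its inverse. A subtree contains with each edge its inverse. A maximal subtree $\mathcal{T}$ of $\mathcal{G}$ (spanning tree) is called geodesic if for each vertex $v$ the length of the reduced path from $o$ to $v$ within $\mathcal{T}$ is the smallest among the lengths of all paths from $o$ to $v$ in $\mathcal{G}$. $\partial F_r$ is the set of right-infinite reduced words in $B$, i.e. functions $w:\{1,2,\ldots\}\to B$ with $w(n)\ne w(n-1)^{-1}$ for $n\ge2$. It is a compact ultrametric space with distance $(2r-1)^{-n}$ between distinct $w_1,w_2$, where $n$ is the length of their maximal common prefix. A basis of the topology is given by the sets $O_u$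 of all $s\in\partial F_r$ having the finite reduced word $u$ as a prefix. $\mu$ is the countably additive Borel measure on $\partial F_r$ with $\mu(\partial F_r)=1$ and $\mu(O_u)=\frac{(2r-1)^{-|u|+1}}{2r}$ for $|u|\ge1$. $Y(\mathcal{T})$ is the set of all right-infinite reduced words that can be read as labels of infinite (reduced) rays of $\mathcal{T}$ originating in $o$; it is a closed, hence measurable, subset of $\partial F_r$. The growth function of $\mathcal{G}$ is $g(n)=$ the number of vertices of $\mathcal{G}$ at distance at most $n$ from $o$. Functions $f,g$ are equivalent if for some nonnegative integers $C,C'$ one has $f(n)\le g(n+C)$ and $g(n)\le f(n+C')$ for all $n\ge0$. The growth is maximal if $g$ is equivalent to $(2r-1)^n$ (the growth of the action of $F_r$ on itself). *)

theory Defs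
  imports
    "HOL-Analysis.Analysis"
    "HOL-Algebra.Coset"
    "Graph_Theory.Digraph_Component"
    "Graph_Theory.Arc_Walk"
begin

section \<open>Free groups and reduced words\<close>

definition letters :: "('g, 'm) monoid_scheme \<Rightarrow> 'g set \<Rightarrow> 'g set" where
  "letters G A = A \<union> m_inv G ` A"

definition reduced_word :: "('g, 'm) monoid_scheme \<Rightarrow> 'g set \<Rightarrow> 'g list \<Rightarrow> bool" where
  "reduced_word G A u \<longleftrightarrow>
     set u \<subseteq> letters G A \<and> (\<forall>i. Suc i < length u \<longrightarrow> u ! Suc i \<noteq> m_inv G (u ! i))"

definition word_value :: "('g, 'm) monoid_scheme \<Rightarrow> 'g list \<Rightarrow> 'g" where
  "word_value G u = foldr (mult G) u (one G)"

text \<open>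
  Disjointness of \<open>A\<close> and its set of inverses is needed: without it the group of order two
  would count as free on its generator, since letters are group elements and not formal symbols.
\<close>

definition free_basis :: "('g, 'm) monoid_scheme \<Rightarrow> 'g set \<Rightarrow> bool" where
  "free_basis G A \<longleftrightarrow>
     group G \<and> A \<subseteq> carrier G \<and> A \<inter> m_inv G ` A = {} \<and>
     (\<forall>g\<in>carrier G. \<exists>!u. reduced_word G A u \<and> word_value G u = g)"


section \<open>The Cayley graph of the action on right cosets\<close>

text \<open>
  The edge with source \<open>s\<close> and label \<open>a\<close> is the pair \<open>(s, a)\<close>, so that loops and
  multiple edges are kept apart by their labels.
\<close>

definition cayley_graph ::
  "('g, 'm) monoid_scheme \<Rightarrow> 'g set \<Rightarrow> 'g set \<Rightarrow> ('g set, 'g set \<times> 'g) pre_digraph" where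
  "cayley_graph G A H =
     \<lparr> verts = rcosets\<^bsub>G\<^esub> H,
       arcs = (rcosets\<^bsub>G\<^esub> H) \<times> letters G A,
       tail = fst,
       head = (\<lambda>(s, a). s #>\<^bsub>G\<^esub> a) \<rparr>"

definition inverse_edge :: "('g, 'm) monoid_scheme \<Rightarrow> 'g set \<times> 'g \<Rightarrow> 'g set \<times> 'g" where
  "inverse_edge G e = (fst e #>\<^bsub>G\<^esub> snd e, m_inv G (snd e))"

definition reduced_path :: "('g, 'm) monoid_scheme \<Rightarrow> ('g set \<times> 'g) list \<Rightarrow> bool" where
  "reduced_path G p \<longleftrightarrow> (\<forall>i. Suc i < length p \<longrightarrow> p ! Suc i \<noteq> inverse_edge G (p ! i))"

text \<open>
  The library predicates \<^const>\<open>tree\<close> and \<^const>\<open>forest\<close> regard an edge followed by its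
  inverse as a cycle, so acyclicity is expressed here by the absence of reduced closed paths.
  As subtrees are closed under inverses, strong connectedness is plain connectedness.
\<close>

definition subtree ::
  "('g, 'm) monoid_scheme \<Rightarrow> 'g set \<Rightarrow> 'g set \<Rightarrow> ('g set, 'g set \<times> 'g) pre_digraph \<Rightarrow> bool" where
  "subtree G A H T \<longleftrightarrow>
     subgraph T (cayley_graph G A H) \<and>
     (\<forall>e\<in>arcs T. inverse_edge G e \<in> arcs T) \<and>
     strongly_connected T \<and>
     \<not> (\<exists>v p. p \<noteq> [] \<and> pre_digraph.awalk T v p v \<and> reduced_path G p)"

definition maximal_subtree ::
  "('g, 'm) monoid_scheme \<Rightarrow> 'g set \<Rightarrow> 'g set \<Rightarrow> ('g set, 'g set \<times> 'g) pre_digraph \<Rightarrow> bool" where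
  "maximal_subtree G A H T \<longleftrightarrow>
     subtree G A H T \<and> (\<forall>T'. subtree G A H T' \<and> subgraph T T' \<longrightarrow> T' = T)"

definition geodesic ::
  "('g, 'm) monoid_scheme \<Rightarrow> 'g set \<Rightarrow> 'g set \<Rightarrow> ('g set, 'g set \<times> 'g) pre_digraph \<Rightarrow> bool" where
  "geodesic G A H T \<longleftrightarrow>
     (\<forall>v\<in>verts T. \<forall>p q. pre_digraph.awalk T H p v \<and> reduced_path G p \<and>
        pre_digraph.awalk (cayley_graph G A H) H q v \<longrightarrow> length p \<le> length q)"


section \<open>Growth\<close>

definition growth :: "('g, 'm) monoid_scheme \<Rightarrow> 'g set \<Rightarrow> 'g set \<Rightarrow> nat \<Rightarrow> nat" where
  "growth G A H n =
     card {v \<in> verts (cayley_graph G A H).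
             \<exists>p. pre_digraph.awalk (cayley_graph G A H) H p v \<and> length p \<le> n}"

definition growth_equivalent :: "(nat \<Rightarrow> nat) \<Rightarrow> (nat \<Rightarrow> nat) \<Rightarrow> bool" where
  "growth_equivalent f g \<longleftrightarrow> (\<exists>C C'. \<forall>n. f n \<le> g (n + C) \<and> g n \<le> f (n + C'))"

definition maximal_growth :: "('g, 'm) monoid_scheme \<Rightarrow> 'g set \<Rightarrow> 'g set \<Rightarrow> bool" where
  "maximal_growth G A H \<longleftrightarrow>
     growth_equivalent (growth G A H) (\<lambda>n. (2 * card A - 1) ^ n)"


section \<open>The boundary and its uniform measure\<close>

text \<open>Infinite words are indexed from \<open>0\<close>.\<close>

definition boundary :: "('g, 'm) monoid_scheme \<Rightarrow> 'g set \<Rightarrow> (nat \<Rightarrow> 'g) set" where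
  "boundary G A =
     {w. (\<forall>n. w n \<in> letters G A) \<and> (\<forall>n. w (Suc n) \<noteq> m_inv G (w n))}"

definition cylinder :: "('g, 'm) monoid_scheme \<Rightarrow> 'g set \<Rightarrow> 'g list \<Rightarrow> (nat \<Rightarrow> 'g) set" where
  "cylinder G A u = {w \<in> boundary G A. \<forall>i < length u. w i = u ! i}"

definition boundary_topology ::
  "('g, 'm) monoid_scheme \<Rightarrow> 'g set \<Rightarrow> (nat \<Rightarrow> 'g) topology" where
  "boundary_topology G A = topology_generated_by {cylinder G A u | u. reduced_word G A u}"

text \<open>
  A Borel measure is determined by its values on cylinders, so at most one measure satisfies this
  predicate; it exists for every free basis of finite rank greater than one.
\<close>

definition uniform_boundary_measure ::
  "('g, 'm) monoid_scheme \<Rightarrow> 'g set \<Rightarrow> (nat \<Rightarrow> 'g) measure \<Rightarrow> bool" where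
  "uniform_boundary_measure G A M \<longleftrightarrow>
     space M = boundary G A \<and>
     sets M = sigma_sets (boundary G A) {U. openin (boundary_topology G A) U} \<and>
     emeasure M (boundary G A) = 1 \<and>
     (\<forall>u. reduced_word G A u \<and> u \<noteq> [] \<longrightarrow>
        emeasure M (cylinder G A u) =
          ennreal ((2 * real (card A) - 1) powi (1 - int (length u)) / (2 * real (card A))))"

definition ray_words ::
  "('g, 'm) monoid_scheme \<Rightarrow> 'g set \<Rightarrow> 'g set \<Rightarrow> ('g set, 'g set \<times> 'g) pre_digraph
     \<Rightarrow> (nat \<Rightarrow> 'g) set" where
  "ray_words G A H T =
     {w \<in> boundary G A. \<exists>e. (\<forall>n. e n \<in> arcs T) \<and> tail T (e 0) = H \<and>
        (\<forall>n. tail T (e (Suc n)) = head T (e n)) \<and>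
        (\<forall>n. e (Suc n) \<noteq> inverse_edge G (e n)) \<and>
        (\<forall>n. snd (e n) = w n)}"

end

theory Submission
  imports Defs "HOL-Probability.Probability_Measure"
begin

text \<open>
  A maximal subtree is spanning, so each vertex is the endpoint of exactly one reduced word that can
  be read in \<open>T\<close> from \<open>H\<close>; as \<open>T\<close> is geodesic, the number \<open>S n\<close> of such words of length \<open>n\<close> is
  the size of the sphere of radius \<open>n\<close>. The set of ray words is the decreasing intersection of the
  unions of the cylinders over these words, so with \<open>q = 2 r - 1\<close> its measure is the limit of the
  decreasing sequence \<open>S n / (2 r q ^ (n - 1))\<close>. If the limit is positive, \<open>S n\<close> alone grows like
  \<open>q ^ n\<close>. If it is zero, then \<open>S n\<close>, and hence also its partial sums, are negligible against
  \<open>q ^ n\<close>.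
\<close>

section \<open>Walks as words\<close>

text \<open>An edge is its source together with its label, so a walk from a given vertex is
  determined by its labels. This lets words stand for walks throughout.\<close>

fun edge_path :: "('g, 'm) monoid_scheme \<Rightarrow> 'g set \<Rightarrow> 'g list \<Rightarrow> ('g set \<times> 'g) list" where
  "edge_path G s [] = []"
| "edge_path G s (a # u) = (s, a) # edge_path G (s #>\<^bsub>G\<^esub> a) u"

abbreviation no_backtrack :: "('g, 'm) monoid_scheme \<Rightarrow> 'g list \<Rightarrow> bool" where
  "no_backtrack G \<equiv> successively (\<lambda>a b. b \<noteq> m_inv G a)"

lemma edge_path_append:
  "edge_path G s (u @ v) = edge_path G s u @ edge_path G (foldl (r_coset G) s u) v"
  by (induction u arbitrary: s) auto

lemma length_edge_path [simp]: "length (edge_path G s u) = length u"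
  by (induction u arbitrary: s) auto

lemma map_snd_edge_path [simp]: "map snd (edge_path G s u) = u"
  by (induction u arbitrary: s) auto

lemma edge_path_eq_iff [simp]: "edge_path G s u = edge_path G s v \<longleftrightarrow> u = v"
  by (metis map_snd_edge_path)

text \<open>In a walk, the edge after \<open>(s, a)\<close> and the inverse of \<open>(s, a)\<close>
  both start at \<open>s #> a\<close>, so they agree exactly when their labels do.\<close>

lemma reduced_path_edge_path: "reduced_path G (edge_path G s u) \<longleftrightarrow> no_backtrack G u"
proof -
  have "reduced_path G p \<longleftrightarrow> successively (\<lambda>e f. f \<noteq> inverse_edge G e) p" for p
    by (simp add: reduced_path_def successively_conv_nth)
  moreover have "successively (\<lambda>e f. f \<noteq> inverse_edge G e) (edge_path G s u) \<longleftrightarrow> no_backtrack G u"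
  proof (induction u arbitrary: s)
    case (Cons a u)
    then show ?case by (cases u) (auto simp: inverse_edge_def)
  qed simp
  ultimately show ?thesis by simp
qed

lemma reduced_word_iff:
  "reduced_word G A u \<longleftrightarrow> set u \<subseteq> letters G A \<and> no_backtrack G u"
  by (simp add: reduced_word_def successively_conv_nth)

text \<open>Leaving \<open>K\<close> general serves the Cayley graph, the subtree and its extension
  by a leaf alike.\<close>

lemma awalk_iff:
  assumes "tail K = fst" "head K = (\<lambda>(s, a). s #>\<^bsub>G\<^esub> a)"
  shows "pre_digraph.awalk K s p v \<longleftrightarrow>
    s \<in> verts K \<and> set p \<subseteq> arcs K \<and> (\<exists>u. p = edge_path G s u \<and> v = foldl (r_coset G) s u)"
proof -
  have "pre_digraph.cas K s p v \<longleftrightarrow> (\<exists>u. p = edge_path G s u \<and> v = foldl (r_coset G) s u)"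
  proof (induction p arbitrary: s)
    case Nil
    have "[] = edge_path G s u \<longleftrightarrow> u = []" for u
      by (metis length_edge_path length_0_conv)
    then show ?case by (auto simp: pre_digraph.cas.simps)
  next
    case (Cons e p)
    obtain t a where e: "e = (t, a)" by fastforce
    have "(\<exists>u. e # p = edge_path G s u \<and> v = foldl (r_coset G) s u) \<longleftrightarrow>
        t = s \<and> (\<exists>u. p = edge_path G (s #>\<^bsub>G\<^esub> a) u \<and> v = foldl (r_coset G) (s #>\<^bsub>G\<^esub> a) u)"
      (is "?L \<longleftrightarrow> ?R")
    proof
      assume ?L
      then obtain u where "e # p = edge_path G s u \<and> v = foldl (r_coset G) s u" by blast
      then show ?R using e by (cases u) auto
    next
      assume ?R
      then obtain u where "t = s" "p = edge_path G (s #>\<^bsub>G\<^esub> a) u"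
          "v = foldl (r_coset G) (s #>\<^bsub>G\<^esub> a) u" by blast
      then show ?L using e by (intro exI[of _ "a # u"]) auto
    qed
    then show ?case using Cons[of "s #>\<^bsub>G\<^esub> a"] e assms by (auto simp: pre_digraph.cas.simps)
  qed
  then show ?thesis by (auto simp: pre_digraph.awalk_def)
qed

lemma not_successively_split:
  "\<not> successively P xs \<Longrightarrow> \<exists>us x y vs. xs = us @ x # y # vs \<and> \<not> P x y"
proof (induction xs)
  case (Cons x xs)
  show ?case
  proof (cases "successively P xs")
    case True
    with Cons.prems obtain y ys where "xs = y # ys" "\<not> P x y"
      by (auto simp: successively_Cons neq_Nil_conv)
    then show ?thesis by (intro exI[of _ "[]"]) auto
  next
    case False
    then show ?thesis using Cons.IH by (metis append_Cons)
  qed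
qed simp


section \<open>Subtrees of the coset graph\<close>

locale coset_graph = group G for G :: "('g, 'm) monoid_scheme" (structure) +
  fixes A H :: "'g set"
  assumes A_closed: "A \<subseteq> carrier G" and H_subgroup: "subgroup H G"
begin

lemma letters_closed: "a \<in> letters G A \<Longrightarrow> a \<in> carrier G"
  using A_closed by (auto simp: letters_def)

lemma inv_letters: "a \<in> letters G A \<Longrightarrow> inv a \<in> letters G A"
  using A_closed by (auto simp: letters_def subset_iff)

lemma vertex_subset: "s \<in> rcosets H \<Longrightarrow> s \<subseteq> carrier G"
  using H_subgroup subgroup.rcosets_carrier[OF _ is_group] by blast

lemma H_vertex: "H \<in> rcosets H"
  using H_subgroup by (rule subgroup.subgroup_in_rcosets[OF _ is_group])

lemma vertex_step:
  assumes "s \<in> rcosets H" "a \<in> carrier G"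
  shows "s #> a \<in> rcosets H"
proof -
  obtain g where "g \<in> carrier G" "s = H #> g"
    using assms by (auto simp: RCOSETS_def)
  then show ?thesis
    using assms H_subgroup
    by (simp add: coset_mult_assoc subgroup.subset rcosetsI)
qed

lemma step_inv:
  assumes "s \<in> rcosets H" "a \<in> carrier G"
  shows "s #> a #> inv a = s"
  using assms by (simp add: coset_mult_assoc vertex_subset)

lemma walk_vertex:
  "s \<in> rcosets H \<Longrightarrow> set u \<subseteq> letters G A \<Longrightarrow> foldl (#>) s u \<in> rcosets H"
  by (induction u arbitrary: s) (auto intro: vertex_step letters_closed)

lemma arcs_edge_path_cayley:
  "s \<in> rcosets H \<Longrightarrow> set (edge_path G s u) \<subseteq> arcs (cayley_graph G A H) \<longleftrightarrow> set u \<subseteq> letters G A"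
proof (induction u arbitrary: s)
  case (Cons a u)
  then show ?case
    using vertex_step[OF Cons.prems, of a] letters_closed[of a] by (auto simp: cayley_graph_def)
qed simp

lemma awalk_cayley:
  "pre_digraph.awalk (cayley_graph G A H) H p v \<longleftrightarrow>
    (\<exists>u. set u \<subseteq> letters G A \<and> p = edge_path G H u \<and> v = foldl (#>) H u)"
proof -
  have "tail (cayley_graph G A H) = fst" "head (cayley_graph G A H) = (\<lambda>(s, a). s #> a)"
    "verts (cayley_graph G A H) = rcosets H"
    by (simp_all add: cayley_graph_def)
  then show ?thesis
    using arcs_edge_path_cayley[OF H_vertex] H_vertex by (auto simp: awalk_iff[of _ G])
qed

lemma growth_words:
  "growth G A H n = card {v. \<exists>u. set u \<subseteq> letters G A \<and> length u \<le> n \<and> v = foldl (#>) H u}"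
proof -
  have "(v \<in> verts (cayley_graph G A H) \<and>
      (\<exists>p. pre_digraph.awalk (cayley_graph G A H) H p v \<and> length p \<le> n)) \<longleftrightarrow>
    (\<exists>u. set u \<subseteq> letters G A \<and> length u \<le> n \<and> v = foldl (#>) H u)" for v
    unfolding awalk_cayley
    using walk_vertex[OF H_vertex] by (fastforce simp: cayley_graph_def)
  then show ?thesis by (simp add: growth_def)
qed

end

section \<open>Uniqueness of reduced words in a subtree\<close>

locale coset_subtree = coset_graph +
  fixes T :: "('g set, 'g set \<times> 'g) pre_digraph"
  assumes subtree: "subtree G A H T"
begin

definition readable :: "'g set \<Rightarrow> 'g list \<Rightarrow> bool" where
  "readable s u \<longleftrightarrow> set (edge_path G s u) \<subseteq> arcs T"

lemma readable_simps [simp]: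
  "readable s []"
  "readable s (a # u) \<longleftrightarrow> (s, a) \<in> arcs T \<and> readable (s #> a) u"
  by (auto simp: readable_def)

lemma readable_append:
  "readable s (u @ v) \<longleftrightarrow> readable s u \<and> readable (foldl (#>) s u) v"
  by (auto simp: readable_def edge_path_append)

lemma subgraph: "subgraph T (cayley_graph G A H)"
  using subtree by (simp add: subtree_def)

lemma tail_T: "tail T = fst" and head_T: "head T = (\<lambda>(s, a). s #> a)"
  using subgraph by (auto simp: subgraph_def compatible_def cayley_graph_def)

lemma wf_T: "wf_digraph T"
  using subgraph by (simp add: subgraph_def)

lemma arcD:
  assumes "(s, a) \<in> arcs T"
  shows "s \<in> verts T" "s #> a \<in> verts T" "a \<in> letters G A" "a \<in> carrier G"
    "(s #> a, inv a) \<in> arcs T"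
proof -
  show "s \<in> verts T" "s #> a \<in> verts T"
    using wf_digraph.tail_in_verts[OF wf_T assms] wf_digraph.head_in_verts[OF wf_T assms]
    by (auto simp: tail_T head_T)
  show "a \<in> letters G A" using subgraph assms by (auto simp: subgraph_def cayley_graph_def)
  then show "a \<in> carrier G" by (rule letters_closed)
  show "(s #> a, inv a) \<in> arcs T"
    using subtree assms by (force simp: subtree_def inverse_edge_def)
qed

lemma vertsD: "s \<in> verts T \<Longrightarrow> s \<in> rcosets H"
  using subgraph by (auto simp: subgraph_def cayley_graph_def)

lemma readable_letters: "readable s u \<Longrightarrow> set u \<subseteq> letters G A"
  by (induction u arbitrary: s) (auto intro: arcD)

lemma awalk_T:
  "pre_digraph.awalk T s p v \<longleftrightarrow>
    s \<in> verts T \<and> (\<exists>u. readable s u \<and> p = edge_path G s u \<and> v = foldl (#>) s u)"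
  by (subst awalk_iff[OF tail_T head_T]) (auto simp: readable_def)

text \<open>This is the acyclicity clause of \<open>subtree\<close>, carried over from closed
  reduced paths to words.\<close>

lemma closed_trivial:
  assumes "s \<in> verts T" "readable s u" "no_backtrack G u" "foldl (#>) s u = s"
  shows "u = []"
proof (rule ccontr)
  assume "u \<noteq> []"
  then have "edge_path G s u \<noteq> []" by (metis length_edge_path length_0_conv)
  moreover have "pre_digraph.awalk T s (edge_path G s u) s"
    using assms by (auto simp: awalk_T)
  ultimately show False
    using subtree assms(3) reduced_path_edge_path unfolding subtree_def by blast
qed

text \<open>\<open>T\<close> contains the inverse of each of its edges, so a walk can be retraced
  with inverted labels in reverse order.\<close>

lemma readable_reverse:
  assumes "s \<in> verts T" "readable s u"
  shows "readable (foldl (#>) s u) (map (m_inv G) (rev u)) \<and>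
    foldl (#>) (foldl (#>) s u) (map (m_inv G) (rev u)) = s"
  using assms
proof (induction u rule: rev_induct)
  case (snoc a u)
  let ?t = "foldl (#>) s u"
  have "(?t, a) \<in> arcs T" "readable s u" using snoc.prems by (auto simp: readable_append)
  then have "(?t #> a, inv a) \<in> arcs T" "?t #> a #> inv a = ?t"
    by (simp_all add: arcD step_inv vertsD)
  then show ?case using snoc.IH[OF snoc.prems(1) \<open>readable s u\<close>] by simp
qed simp

text \<open>
  If the last letters of two distinct words differ, the first word followed by the inverse of the
  second is a reduced closed path.
\<close>

lemma word_unique:
  assumes "s \<in> verts T" "readable s u" "readable s v" "no_backtrack G u" "no_backtrack G v"
    "length u = length v" "foldl (#>) s u = foldl (#>) s v"
  shows "u = v"
  using assms(6,2-5,7)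
proof (induction u v rule: rev_induct2)
  case (4 a u b v)
  have r: "readable s u" "readable s v" and e: "(foldl (#>) s u, a) \<in> arcs T"
      "(foldl (#>) s v, b) \<in> arcs T"
    using 4 by (auto simp: readable_append)
  have ab: "a \<in> carrier G" "b \<in> carrier G" using e arcD by blast+
  have "a = b"
  proof (rule ccontr)
    assume "a \<noteq> b"
    let ?w = "(u @ [a]) @ map (m_inv G) (rev (v @ [b]))"
    have rb: "readable (foldl (#>) s (v @ [b])) (map (m_inv G) (rev (v @ [b])))"
         "foldl (#>) (foldl (#>) s (v @ [b])) (map (m_inv G) (rev (v @ [b]))) = s"
      using readable_reverse[OF assms(1) 4(4)] by auto
    have c: "set (v @ [b]) \<subseteq> carrier G"
      using readable_letters[OF 4(4)] letters_closed by blast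
    have "no_backtrack G (map (m_inv G) (rev (v @ [b])))"
      unfolding successively_map successively_rev
      by (rule successively_mono[OF 4(6)]) (use c in \<open>auto simp: inv_equality\<close>)
    \<comment> \<open>At the junction \<open>a\<close> is followed by \<open>inv b\<close>;
      backtracking there would mean \<open>inv b = inv a\<close>, hence
      \<open>a = b\<close>.\<close>
    then have "no_backtrack G ?w"
      unfolding successively_append_iff[of _ "u @ [a]"]
      using 4(5) \<open>a \<noteq> b\<close> ab inj_onD[OF inv_inj, of a b] by auto
    moreover have "readable s ?w" "foldl (#>) s ?w = s"
      using rb 4(3,7) unfolding readable_append foldl_append by auto
    ultimately have "?w = []" using closed_trivial[OF assms(1)] by blast
    then show False by simp
  qed
  \<comment> \<open>Stepping back along the common last letter brings both walks to the same vertex,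
    so the induction hypothesis applies to \<open>u\<close> and \<open>v\<close>.\<close>
  moreover have "foldl (#>) s u = foldl (#>) s v"
  proof -
    have "foldl (#>) s u = foldl (#>) s u #> a #> inv a"
      "foldl (#>) s v = foldl (#>) s v #> b #> inv b"
      using e ab by (auto simp: step_inv vertsD arcD)
    then show ?thesis using 4(7) \<open>a = b\<close> by simp
  qed
  ultimately show ?case using 4 r by (auto simp: successively_append_iff)
qed auto

text \<open>
  The subtree is extended by a leaf: a path without backtracking can enter the new vertex only with
  its last edge and leave it only with its first.
\<close>

lemma subtree_extend:
  assumes s: "s \<in> verts T" and a: "a \<in> letters G A" and new: "s #> a \<notin> verts T"
  shows "\<exists>T'. subtree G A H T' \<and> subgraph T T' \<and> s #> a \<in> verts T'"
proof -
  define w where "w = s #> a"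
  define T' where "T' = T\<lparr>verts := insert w (verts T), arcs := {(s, a), (w, inv a)} \<union> arcs T\<rparr>"
  have ac: "a \<in> carrier G" using a by (rule letters_closed)
  have sv: "s \<in> rcosets H" using s by (rule vertsD)
  have wv: "w \<in> rcosets H" unfolding w_def using sv ac by (rule vertex_step)
  have ret: "w #> inv a = s" unfolding w_def using sv ac by (rule step_inv)
  have sw: "s \<noteq> w" "w \<notin> verts T" using s new by (auto simp: w_def)
  have T': "verts T' = insert w (verts T)" "arcs T' = {(s, a), (w, inv a)} \<union> arcs T"
    "tail T' = fst" "head T' = (\<lambda>(s, a). s #> a)"
    by (simp_all add: T'_def tail_T head_T)
  have wf: "wf_digraph T'"
    by unfold_locales (use s ret arcD in \<open>auto simp: T' w_def\<close>)
  have cay: "subgraph T' (cayley_graph G A H)"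
    using subgraph wf sv wv a inv_letters[OF a]
    by (auto simp: subgraph_def compatible_def T' cayley_graph_def)
  have sub: "subgraph T T'"
    using wf wf_T by (auto simp: subgraph_def compatible_def T' tail_T head_T)
  have sym: "\<forall>e\<in>arcs T'. inverse_edge G e \<in> arcs T'"
    using ret ac arcD by (auto simp: T' inverse_edge_def w_def)
  have conn: "strongly_connected T'"
  proof -
    have "(s, w) \<in> arcs_ends T'" "(w, s) \<in> arcs_ends T'"
      using ret by (force simp: arcs_ends_def arc_to_ends_def T' w_def)+
    then have sws: "s \<rightarrow>\<^sup>*\<^bsub>T'\<^esub> w" "w \<rightarrow>\<^sup>*\<^bsub>T'\<^esub> s"
      using wf_digraph.reachable_adjI[OF wf] by blast+
    have "u \<rightarrow>\<^sup>*\<^bsub>T'\<^esub> v" if "u \<in> verts T" "v \<in> verts T" for u v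
      using that subtree pre_digraph.reachable_mono[OF _ sub]
      by (auto simp: subtree_def strongly_connected_def)
    \<comment> \<open>Connectedness is checked through \<open>s\<close>, the vertex at which the
      leaf is attached.\<close>
    then have "u \<rightarrow>\<^sup>*\<^bsub>T'\<^esub> s" "s \<rightarrow>\<^sup>*\<^bsub>T'\<^esub> u" if "u \<in> verts T'" for u
      using that s sws by (auto simp: T')
    then show ?thesis
      using wf_digraph.reachable_trans[OF wf] unfolding strongly_connected_def
      by (metis T'(1) insert_not_empty)
  qed
  have from_T: "readable x u \<or> foldl (#>) x u = w"
    if "x \<in> verts T" "set (edge_path G x u) \<subseteq> arcs T'" "no_backtrack G u" for x u
    using that
  proof (induction u arbitrary: x)
    case (Cons b u)
    show ?case
    proof (cases "(x, b) \<in> arcs T")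
      case True
      have "readable (x #> b) u \<or> foldl (#>) (x #> b) u = w"
        by (rule Cons.IH) (use Cons.prems True in \<open>auto simp: arcD successively_Cons\<close>)
      with True show ?thesis by simp
    next
      case False
      then have xb: "x = s" "b = a" using Cons.prems sw by (auto simp: T')
      have "u = []"
      proof (cases u)
        case (Cons c u')
        have "(w, c) \<in> arcs T'" using Cons.prems(2) Cons xb by (auto simp: w_def)
        then have "c = inv a" using sw arcD(1) by (auto simp: T')
        then show ?thesis using Cons.prems(3) Cons xb by simp
      qed simp
      then show ?thesis using xb by (simp add: w_def)
    qed
  qed simp
  have closed_T: "u = []"
    if "x \<in> verts T" "set (edge_path G x u) \<subseteq> arcs T'" "no_backtrack G u" "foldl (#>) x u = x" for x u
    using from_T[OF that(1-3)] that sw closed_trivial by auto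
  have closed: "u = []"
    if "x \<in> verts T'" "set (edge_path G x u) \<subseteq> arcs T'" "no_backtrack G u" "foldl (#>) x u = x" for x u
  proof (cases "x \<in> verts T")
    case True
    then show ?thesis using closed_T that by blast
  next
    case False
    then have x: "x = w" using that by (simp add: T')
    \<comment> \<open>A closed walk at \<open>w\<close> must leave by \<open>inv a\<close> and
      return by \<open>a\<close>. What lies between is a closed walk at \<open>s\<close>, hence
      empty, and \<open>[inv a, a]\<close> backtracks.\<close>
    show ?thesis
    proof (rule ccontr)
      assume "u \<noteq> []"
      then obtain c u' where u: "u = c # u'" by (cases u) auto
      have "(w, c) \<in> arcs T'" using that(2) u x by simp
      then have c: "c = inv a" using sw arcD(1) by (auto simp: T')
      have u': "foldl (#>) s u' = w" using that(4) u x c ret by simp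
      then have "u' \<noteq> []" using sw by auto
      then obtain u'' d where u'': "u' = u'' @ [d]" by (metis rev_exhaust)
      have d: "(foldl (#>) s u'', d) \<in> arcs T'" "foldl (#>) s u'' #> d = w"
        using that(2) u x c ret u' u'' by (auto simp: edge_path_append)
      then have "foldl (#>) s u'' = s" "d = a"
        using sw arcD(2) ret by (auto simp: T')
      moreover have "no_backtrack G u''" "set (edge_path G s u'') \<subseteq> arcs T'"
        using that(2,3) u u'' x c ret
        by (auto simp: edge_path_append successively_append_iff successively_Cons)
      ultimately have "u = [inv a, a]" using closed_T[OF s] u u'' c by simp
      then show False using that(3) ac by simp
    qed
  qed
  have "\<not> (\<exists>v p. p \<noteq> [] \<and> pre_digraph.awalk T' v p v \<and> reduced_path G p)"
  proof safe
    fix v p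
    assume "p \<noteq> []" "pre_digraph.awalk T' v p v" "reduced_path G p"
    then obtain u where u: "v \<in> verts T'" "set p \<subseteq> arcs T'" "p = edge_path G v u"
      "v = foldl (#>) v u" "no_backtrack G u"
      using reduced_path_edge_path by (auto simp: awalk_iff[OF T'(3,4)])
    then show False using closed[of v u] \<open>p \<noteq> []\<close> by auto
  qed
  then have "subtree G A H T'"
    using cay sym conn by (simp add: subtree_def)
  then show ?thesis using sub T'(1) w_def by blast
qed

text \<open>A letter leading out of \<open>verts T\<close> would give a larger subtree by
  \<open>subtree_extend\<close>, so \<open>verts T\<close> is closed under all letters. As the basis
  generates \<open>G\<close>, words lead from one coset to every other.\<close>

lemma maximal_spanning:
  assumes max: "maximal_subtree G A H T" and basis: "free_basis G A"
  shows "verts T = rcosets H"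
proof -
  have step: "s #> a \<in> verts T" if "s \<in> verts T" "a \<in> letters G A" for s a
    using subtree_extend[OF that] max by (auto simp: maximal_subtree_def)
  have walk: "foldl (#>) s u \<in> verts T" if "s \<in> verts T" "set u \<subseteq> letters G A" for s u
    using that by (induction u arbitrary: s) (auto intro: step)
  have value_closed: "word_value G u \<in> carrier G" if "set u \<subseteq> letters G A" for u
    using that by (induction u) (auto simp: word_value_def letters_closed)
  have fold: "foldl (#>) s u = s #> word_value G u"
    if "s \<in> rcosets H" "set u \<subseteq> letters G A" for s u
    using that
  proof (induction u arbitrary: s)
    case Nil
    then show ?case by (simp add: word_value_def vertex_subset)
  next
    case (Cons a u)
    have "foldl (#>) s (a # u) = s #> a #> word_value G u"
      using Cons by (simp add: vertex_step letters_closed)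
    also have "\<dots> = s #> (a \<otimes> word_value G u)"
      using Cons.prems by (intro coset_mult_assoc) (auto simp: vertex_subset letters_closed value_closed)
    finally show ?case by (simp add: word_value_def)
  qed
  obtain s where s: "s \<in> verts T"
    using subtree by (auto simp: subtree_def strongly_connected_def)
  then obtain g where g: "g \<in> carrier G" "s = H #> g"
    using vertsD by (auto simp: RCOSETS_def)
  have "t \<in> verts T" if "t \<in> rcosets H" for t
  proof -
    obtain h where h: "h \<in> carrier G" "t = H #> h"
      using \<open>t \<in> rcosets H\<close> by (auto simp: RCOSETS_def)
    \<comment> \<open>Right multiplication by this element carries \<open>H #> g\<close> to
      \<open>H #> h\<close>.\<close>
    have "inv g \<otimes> h \<in> carrier G" using g h by simp
    then obtain u where u: "reduced_word G A u" "word_value G u = inv g \<otimes> h"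
      using basis unfolding free_basis_def by metis
    have "foldl (#>) s u = s #> (inv g \<otimes> h)"
      using fold[OF vertsD[OF s]] u by (simp add: reduced_word_def)
    also have "\<dots> = t"
      using g h H_subgroup
      by (simp add: coset_mult_assoc subgroup.subset inv_solve_left' m_assoc[symmetric])
    finally show ?thesis using walk[OF s] u(1) by (auto simp: reduced_word_def)
  qed
  then show ?thesis using vertsD by blast
qed

text \<open>A shortest readable word to \<open>v\<close> cannot backtrack: deleting a factor
  \<open>a\<close>, \<open>inv a\<close> changes neither readability nor the endpoint.\<close>

lemma reduced_walk_exists:
  assumes "s \<in> verts T" "v \<in> verts T"
  shows "\<exists>u. readable s u \<and> no_backtrack G u \<and> foldl (#>) s u = v"
proof -
  let ?P = "\<lambda>u. readable s u \<and> foldl (#>) s u = v"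
  have "s \<rightarrow>\<^sup>*\<^bsub>T\<^esub> v" using assms subtree by (simp add: subtree_def strongly_connected_def)
  then have "\<exists>u. ?P u"
    using wf_digraph.reachable_awalk[OF wf_T] by (auto simp: awalk_T)
  then obtain u where u: "?P u" and min: "\<And>u'. ?P u' \<Longrightarrow> length u \<le> length u'"
    using ex_has_least_nat[of ?P _ length] by metis
  have "no_backtrack G u"
  proof (rule ccontr)
    assume "\<not> no_backtrack G u"
    then obtain u1 a u2 where e: "u = u1 @ a # inv a # u2"
      using not_successively_split by blast
    have "(foldl (#>) s u1, a) \<in> arcs T" using u e by (simp add: readable_append)
    then have "foldl (#>) s u1 #> a #> inv a = foldl (#>) s u1"
      by (intro step_inv vertsD arcD)
    then have "?P (u1 @ u2)" using u e by (simp add: readable_append)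
    then show False using min e by fastforce
  qed
  then show ?thesis using u by blast
qed


section \<open>Spheres and the boundary\<close>

definition level :: "nat \<Rightarrow> 'g list set" where
  "level n = {u. length u = n \<and> no_backtrack G u \<and> readable H u}"

lemma level_reduced: "u \<in> level n \<Longrightarrow> reduced_word G A u"
  using readable_letters by (auto simp: level_def reduced_word_iff)

lemma level_0: "level 0 = {[]}"
  by (auto simp: level_def)

lemma finite_words:
  assumes "finite A"
  shows "finite {u. set u \<subseteq> letters G A \<and> length u \<le> n}"
  using assms by (intro finite_lists_length_le) (simp add: letters_def)

lemma finite_level:
  assumes "finite A"
  shows "finite (level n)"
  by (rule finite_subset[OF _ finite_words[OF assms, of n]])
    (use readable_letters in \<open>auto simp: level_def\<close>)

text \<open>By \<open>word_unique\<close>, the words of one level have distinct endpoints, all of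
  them in the ball of radius \<open>n\<close>.\<close>

lemma card_level_le_growth:
  assumes "finite A" "H \<in> verts T"
  shows "card (level n) \<le> growth G A H n"
proof -
  have "inj_on (foldl (#>) H) (level n)"
    using word_unique[OF assms(2)] by (auto simp: level_def inj_on_def)
  then have "card (level n) = card (foldl (#>) H ` level n)"
    by (simp add: card_image)
  also have "\<dots> \<le> card (foldl (#>) H ` {u. set u \<subseteq> letters G A \<and> length u \<le> n})"
    by (rule card_mono[OF finite_imageI[OF finite_words[OF assms(1)]]])
      (use readable_letters in \<open>auto simp: level_def\<close>)
  also have "foldl (#>) H ` {u. set u \<subseteq> letters G A \<and> length u \<le> n} =
      {v. \<exists>u. set u \<subseteq> letters G A \<and> length u \<le> n \<and> v = foldl (#>) H u}" by auto
  finally show ?thesis by (simp add: growth_words)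
qed

text \<open>A vertex of the ball is reached in \<open>T\<close> by a reduced word, and geodesicity
  makes this word no longer than \<open>n\<close>; it therefore lies in one of the levels up to
  \<open>n\<close>.\<close>

lemma growth_le_sum_level:
  assumes "finite A" "verts T = rcosets H" "geodesic G A H T"
  shows "growth G A H n \<le> (\<Sum>k\<le>n. card (level k))"
proof -
  have "{v. \<exists>u. set u \<subseteq> letters G A \<and> length u \<le> n \<and> v = foldl (#>) H u}
      \<subseteq> foldl (#>) H ` (\<Union>k\<le>n. level k)"
  proof clarify
    fix u assume u: "set u \<subseteq> letters G A" "length u \<le> n"
    let ?v = "foldl (#>) H u"
    have v: "?v \<in> verts T" using walk_vertex[OF H_vertex u(1)] assms(2) by simp
    obtain u' where u': "readable H u'" "no_backtrack G u'" "foldl (#>) H u' = ?v"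
      using reduced_walk_exists[OF _ v] H_vertex assms(2) by metis
    have "length (edge_path G H u') \<le> length (edge_path G H u)"
    proof -
      have "pre_digraph.awalk T H (edge_path G H u') ?v"
        using u' H_vertex assms(2) by (auto simp: awalk_T)
      moreover have "pre_digraph.awalk (cayley_graph G A H) H (edge_path G H u) ?v"
        using u by (auto simp: awalk_cayley)
      ultimately show ?thesis
        using assms(3) v u'(2) reduced_path_edge_path unfolding geodesic_def by blast
    qed
    then have "u' \<in> (\<Union>k\<le>n. level k)" using u u' by (auto simp: level_def)
    then show "?v \<in> foldl (#>) H ` (\<Union>k\<le>n. level k)" using u'(3) by (metis image_eqI)
  qed
  then have "growth G A H n \<le> card (foldl (#>) H ` (\<Union>k\<le>n. level k))"
    unfolding growth_words by (intro card_mono finite_imageI finite_UN_I) (auto intro: finite_level assms)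
  also have "\<dots> \<le> card (\<Union>k\<le>n. level k)"
    by (intro card_image_le finite_UN_I) (auto intro: finite_level assms)
  also have "\<dots> \<le> (\<Sum>k\<le>n. card (level k))" by (rule card_UN_le) simp
  finally show ?thesis .
qed

section \<open>The ray words as a decreasing limit of unions of cylinders\<close>

definition level_cylinders :: "nat \<Rightarrow> (nat \<Rightarrow> 'g) set" where
  "level_cylinders n = (\<Union>u\<in>level n. cylinder G A u)"

text \<open>The only word of length \<open>n\<close> whose cylinder can contain \<open>w\<close> is
  the prefix of \<open>w\<close>, and prefixes of boundary words never backtrack.\<close>

lemma level_cylinders_iff:
  "w \<in> level_cylinders n \<longleftrightarrow> w \<in> boundary G A \<and> readable H (map w [0..<n])"
proof -
  have "w \<in> cylinder G A u \<longleftrightarrow> w \<in> boundary G A \<and> u = map w [0..<n]" if "length u = n" for u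
    using that by (auto simp: cylinder_def list_eq_iff_nth_eq)
  moreover have "no_backtrack G (map w [0..<n])" if "w \<in> boundary G A"
    using that by (auto simp: boundary_def successively_conv_nth)
  ultimately show ?thesis by (auto simp: level_cylinders_def level_def)
qed

lemma decseq_level_cylinders: "decseq level_cylinders"
  by (rule decseq_SucI) (auto simp: level_cylinders_iff readable_append)

text \<open>The labels determine a ray from \<open>H\<close>: its edge number \<open>n\<close> must
  be \<open>(pos w n, w n)\<close>, where \<open>pos w n\<close> is the endpoint of the prefix of
  length \<open>n\<close>. So a ray exists as soon as every prefix is readable.\<close>

lemma ray_words_eq: "ray_words G A H T = (\<Inter>n. level_cylinders n)"
proof -
  define pos where "pos w n = foldl (#>) H (map w [0..<n])" for w n
  have pos: "pos w 0 = H" "pos w (Suc n) = pos w n #> w n" for w n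
    by (simp_all add: pos_def)
  have readable: "(\<forall>n. readable H (map w [0..<n])) \<longleftrightarrow> (\<forall>n. (pos w n, w n) \<in> arcs T)" for w
  proof
    assume "\<forall>n. readable H (map w [0..<n])"
    then have "readable H (map w [0..<Suc n])" for n by blast
    then show "\<forall>n. (pos w n, w n) \<in> arcs T" by (simp add: pos_def readable_append)
  next
    assume arcs: "\<forall>n. (pos w n, w n) \<in> arcs T"
    show "\<forall>n. readable H (map w [0..<n])"
    proof
      fix n show "readable H (map w [0..<n])"
        using arcs by (induction n) (auto simp: readable_append pos_def)
    qed
  qed
  have "w \<in> ray_words G A H T \<longleftrightarrow> w \<in> boundary G A \<and> (\<forall>n. (pos w n, w n) \<in> arcs T)" for w
  proof
    assume w: "w \<in> ray_words G A H T"
    then obtain e where e: "\<And>n. e n \<in> arcs T" "fst (e 0) = H"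
        "\<And>n. fst (e (Suc n)) = fst (e n) #> snd (e n)" "\<And>n. snd (e n) = w n"
      unfolding ray_words_def tail_T head_T case_prod_beta by blast
    have "fst (e n) = pos w n" for n
      by (induction n) (simp_all add: e pos)
    then have "e n = (pos w n, w n)" for n by (simp add: prod_eq_iff e)
    then show "w \<in> boundary G A \<and> (\<forall>n. (pos w n, w n) \<in> arcs T)"
      using w e(1) by (metis (no_types, lifting) ray_words_def mem_Collect_eq)
  next
    assume "w \<in> boundary G A \<and> (\<forall>n. (pos w n, w n) \<in> arcs T)"
    then show "w \<in> ray_words G A H T"
      by (auto simp: ray_words_def tail_T head_T pos inverse_edge_def boundary_def
          intro!: exI[of _ "\<lambda>n. (pos w n, w n)"])
  qed
  then show ?thesis by (auto simp: level_cylinders_iff simp flip: readable)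
qed

lemma cylinder_measurable:
  assumes "uniform_boundary_measure G A M" "reduced_word G A u"
  shows "cylinder G A u \<in> sets M"
proof -
  have "openin (boundary_topology G A) (cylinder G A u)"
    using assms(2) unfolding boundary_topology_def by (intro topology_generated_by_Basis) blast
  then show ?thesis
    using assms(1) by (auto simp: uniform_boundary_measure_def intro: sigma_sets.Basic)
qed

text \<open>Cylinders over distinct words of equal length are disjoint, so their measures add. The
  cylinder formula covers nonempty words only; hence \<open>Suc n\<close>, which turns its exponent
  into \<open>-n\<close>.\<close>

lemma measure_level_cylinders:
  assumes M: "uniform_boundary_measure G A M" and "finite A" "card A > 0"
  shows "level_cylinders n \<in> sets M"
    "measure M (level_cylinders (Suc n)) =
      card (level (Suc n)) / (2 * real (card A) * (2 * real (card A) - 1) ^ n)"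
proof -
  have sets: "cylinder G A u \<in> sets M" if "u \<in> level n" for u n
    using cylinder_measurable[OF M] level_reduced that by blast
  then show "level_cylinders n \<in> sets M"
    unfolding level_cylinders_def using finite_level[OF \<open>finite A\<close>] by blast
  have disj: "disjoint_family_on (cylinder G A) (level (Suc n))"
    by (auto simp: disjoint_family_on_def level_def cylinder_def list_eq_iff_nth_eq)
  have pos: "2 * real (card A) - 1 > 0" using \<open>card A > 0\<close> by linarith
  have em: "emeasure M (cylinder G A u) = ennreal (1 / (2 * real (card A) * (2 * real (card A) - 1) ^ n))"
    if "u \<in> level (Suc n)" for u
  proof -
    have "reduced_word G A u" "length u = Suc n" "u \<noteq> []"
      using that level_reduced by (auto simp: level_def)
    then have "emeasure M (cylinder G A u) =
        ennreal ((2 * real (card A) - 1) powi (1 - int (Suc n)) / (2 * real (card A)))"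
      using M by (simp add: uniform_boundary_measure_def)
    also have "(2 * real (card A) - 1) powi (1 - int (Suc n)) = 1 / (2 * real (card A) - 1) ^ n"
      by (simp add: power_int_minus divide_inverse)
    finally show ?thesis by (simp add: mult.commute)
  qed
  then have "measure M (cylinder G A u) = 1 / (2 * real (card A) * (2 * real (card A) - 1) ^ n)"
    if "u \<in> level (Suc n)" for u
    using that pos by (simp add: measure_def)
  moreover have "measure M (level_cylinders (Suc n)) = (\<Sum>u\<in>level (Suc n). measure M (cylinder G A u))"
    unfolding level_cylinders_def
    by (rule measure_finite_Union[OF finite_level[OF \<open>finite A\<close>] _ disj]) (use sets em in auto)
  ultimately show "measure M (level_cylinders (Suc n)) =
      card (level (Suc n)) / (2 * real (card A) * (2 * real (card A) - 1) ^ n)"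
    by simp
qed

text \<open>\<open>d n\<close> is the measure of \<open>level_cylinders (Suc n)\<close>: continuity
  from above gives the limit, monotonicity the lower bound. Total mass one gives the upper bound,
  which later limits the size of levels without counting reduced words.\<close>

lemma level_density:
  assumes M: "uniform_boundary_measure G A M" and "finite A" "card A > 0"
  defines "d \<equiv> \<lambda>n. card (level (Suc n)) / (2 * real (card A) * (2 * real (card A) - 1) ^ n)"
  shows "d \<longlonglongrightarrow> measure M (ray_words G A H T)"
    "measure M (ray_words G A H T) \<le> d n" "d n \<le> 1"
proof -
  have space: "emeasure M (space M) = 1" using M by (simp add: uniform_boundary_measure_def)
  interpret prob_space M by (rule prob_spaceI[OF space])
  note lc = measure_level_cylinders[OF assms(1-3)]
  have d: "d n = measure M (level_cylinders (Suc n))" for n using lc(2) by (simp add: d_def)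
  have "(\<lambda>n. measure M (level_cylinders n)) \<longlonglongrightarrow> measure M (\<Inter>n. level_cylinders n)"
    using lc(1) decseq_level_cylinders by (intro finite_Lim_measure_decseq) auto
  then show "d \<longlonglongrightarrow> measure M (ray_words G A H T)"
    unfolding d ray_words_eq by (rule LIMSEQ_Suc)
  show "measure M (ray_words G A H T) \<le> d n"
    unfolding d ray_words_eq using lc(1) by (intro finite_measure_mono) auto
  show "d n \<le> 1" unfolding d by simp
qed

end


section \<open>Comparison of growth rates\<close>

text \<open>\<open>(q + 1) * q ^ k\<close> is the size of the sphere of radius \<open>Suc k\<close>
  in the free group. The induction closes because \<open>2 * q + 1 \<le> q * q\<close> for
  \<open>q \<ge> 3\<close>.\<close>

lemma sum_le_geometric:
  fixes S :: "nat \<Rightarrow> real"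
  assumes "q \<ge> 3" "S 0 \<le> 1" "\<And>k. S (Suc k) \<le> (q + 1) * q ^ k"
  shows "(\<Sum>k\<le>n. S k) \<le> q ^ Suc n"
proof (induction n)
  case (Suc n)
  have "(\<Sum>k\<le>Suc n. S k) \<le> q ^ Suc n + (q + 1) * q ^ n"
    using Suc assms(3)[of n] by simp
  also have "\<dots> = (2 * q + 1) * q ^ n" by (simp add: algebra_simps)
  also have "\<dots> \<le> (q * q) * q ^ n"
  proof (rule mult_right_mono)
    have "3 * q \<le> q * q" using assms(1) by (intro mult_right_mono) auto
    then show "2 * q + 1 \<le> q * q" using assms(1) by linarith
  qed (use assms(1) in simp)
  finally show ?case by simp
qed (use assms in simp)

text \<open>Vanishing density makes all late terms small multiples of \<open>q ^ k\<close>; their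
  sum is dominated by its last terms, and the early terms contribute only a constant. No fixed shift
  \<open>C\<close> can compensate for this.\<close>

lemma sum_not_geometric:
  fixes S :: "nat \<Rightarrow> real"
  assumes q: "q \<ge> 3" and lim: "(\<lambda>n. S (Suc n) / ((q + 1) * q ^ n)) \<longlonglongrightarrow> 0"
  shows "\<exists>n. (\<Sum>k\<le>n + C. S k) < q ^ n"
proof (rule ccontr)
  assume "\<not> ?thesis"
  then have big: "q ^ n \<le> (\<Sum>k\<le>n + C. S k)" for n by (simp add: not_less)
  \<comment> \<open>Chosen so that \<open>4 * \<epsilon> * q ^ (n + C)\<close> is half of
    \<open>q ^ n\<close>. One factor 2 comes from \<open>q + 1 \<le> 2 * q\<close>, another from the
    geometric summation.\<close>
  define \<epsilon> where "\<epsilon> = 1 / (8 * q ^ C)"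
  have "\<epsilon> > 0" using q by (simp add: \<epsilon>_def)
  then have "\<forall>\<^sub>F n in sequentially. S (Suc n) / ((q + 1) * q ^ n) < \<epsilon>"
    using lim by (rule order_tendstoD(2)[rotated])
  then obtain N where N: "\<And>n. n \<ge> N \<Longrightarrow> S (Suc n) / ((q + 1) * q ^ n) < \<epsilon>"
    unfolding eventually_sequentially by blast
  have step: "S (Suc n) \<le> 2 * \<epsilon> * q ^ Suc n" if "n \<ge> N" for n
  proof -
    have "S (Suc n) \<le> \<epsilon> * ((q + 1) * q ^ n)"
      using N[OF that] q by (simp add: divide_less_eq)
    also have "\<dots> \<le> \<epsilon> * ((2 * q) * q ^ n)"
      using q \<open>\<epsilon> > 0\<close> by (intro mult_left_mono mult_right_mono) auto
    finally show ?thesis by (simp add: mult_ac)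
  qed
  define K where "K = (\<Sum>k\<le>N. S k)"
  have sum: "(\<Sum>k\<le>N + m. S k) \<le> K + 4 * \<epsilon> * q ^ (N + m)" for m
  proof (induction m)
    case 0
    then show ?case using q \<open>\<epsilon> > 0\<close> by (simp add: K_def)
  next
    case (Suc m)
    have "(\<Sum>k\<le>N + Suc m. S k) \<le> K + 4 * \<epsilon> * q ^ (N + m) + 2 * \<epsilon> * q ^ Suc (N + m)"
      using Suc step[of "N + m"] by simp
    \<comment> \<open>As \<open>q \<ge> 2\<close>, the old tail bound is at most the bound on the
      new term, so the constant 4 survives the induction.\<close>
    also have "4 * \<epsilon> * q ^ (N + m) \<le> 2 * \<epsilon> * q ^ Suc (N + m)"
      using q \<open>\<epsilon> > 0\<close> by simp
    finally show ?case by simp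
  qed
  have "q ^ (N + m) \<le> 2 * K" for m
  proof -
    \<comment> \<open>Half of the left side is absorbed, leaving powers of \<open>q\<close> bounded
      by the constant \<open>2 * K\<close>.\<close>
    have "q ^ (N + m) \<le> K + 4 * \<epsilon> * q ^ (N + m + C)"
      using big[of "N + m"] sum[of "m + C"] by (simp add: add.assoc)
    also have "4 * \<epsilon> * q ^ (N + m + C) = q ^ (N + m) / 2"
      using q by (simp add: \<epsilon>_def power_add)
    finally show ?thesis by simp
  qed
  moreover obtain m where "2 * K < q ^ m" using real_arch_pow[of q] q by auto
  moreover have "q ^ m \<le> q ^ (N + m)" using q by (intro power_increasing) auto
  ultimately show False by (meson not_less order_trans)
qed

section \<open>Maximal growth as positivity of the limiting density\<close>

theorem theorem7:
  fixes G :: "('g, 'm) monoid_scheme"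
    and A H :: "'g set"
    and r :: nat
    and M :: "(nat \<Rightarrow> 'g) measure"
  assumes "free_basis G A"
    and "finite A"
    and "card A = r"
    and "r > 1"
    and "subgroup H G"
    and "uniform_boundary_measure G A M"
  shows "(maximal_growth G A H \<longrightarrow>
            (\<forall>T. maximal_subtree G A H T \<and> geodesic G A H T \<longrightarrow>
                 measure M (ray_words G A H T) > 0)) \<and>
         ((\<exists>T. maximal_subtree G A H T \<and> geodesic G A H T \<and>
                 measure M (ray_words G A H T) > 0) \<longrightarrow>
            maximal_growth G A H)"
proof -
  define q where "q = 2 * real r - 1"
  \<comment> \<open>The growth base uses truncated subtraction on naturals; \<open>r > 1\<close>
    makes its cast agree with \<open>q\<close>.\<close>
  have q: "q \<ge> 3" "2 * real r = q + 1" "real (2 * card A - 1) = q"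
    using assms(3,4) by (auto simp: q_def of_nat_diff)
  interpret coset_graph G A H
    using assms(1,5) by (auto simp: free_basis_def coset_graph_def coset_graph_axioms_def)
  \<comment> \<open>The equivalence holds for each maximal geodesic subtree separately, which yields
    both the universal and the existential claim.\<close>
  have main: "maximal_growth G A H \<longleftrightarrow> measure M (ray_words G A H T) > 0"
    if T: "maximal_subtree G A H T" "geodesic G A H T" for T
  proof -
    interpret coset_subtree G A H T
      using T(1) by unfold_locales (simp add: maximal_subtree_def)
    have span: "verts T = rcosets\<^bsub>G\<^esub> H" using maximal_spanning[OF T(1) assms(1)] .
    define S where "S n = real (card (level n))" for n
    define m where "m = measure M (ray_words G A H T)"
    have dens: "(\<lambda>n. S (Suc n) / ((q + 1) * q ^ n)) \<longlonglongrightarrow> m"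
      "m \<le> S (Suc n) / ((q + 1) * q ^ n)" "S (Suc n) / ((q + 1) * q ^ n) \<le> 1" for n
      using level_density[OF assms(6,2)] assms(3,4)
      by (simp_all add: S_def m_def q_def)
    have upper: "growth G A H n \<le> (\<Sum>k\<le>n. S k)" for n
      using growth_le_sum_level[OF assms(2) span T(2), of n] by (simp add: S_def flip: of_nat_sum)
    have lower: "S n \<le> growth G A H n" for n
      using card_level_le_growth[OF assms(2)] H_vertex span by (simp add: S_def)
    show ?thesis
    proof
      assume "maximal_growth G A H"
      then obtain C where C: "\<And>n. (2 * card A - 1) ^ n \<le> growth G A H (n + C)"
        unfolding maximal_growth_def growth_equivalent_def by blast
      have "q ^ n \<le> (\<Sum>k\<le>n + C. S k)" for n
      proof -
        have "q ^ n = real ((2 * card A - 1) ^ n)" using q(3) by simp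
        also have "\<dots> \<le> growth G A H (n + C)" using C by (simp only: of_nat_le_iff)
        finally show ?thesis using upper[of "n + C"] by simp
      qed
      \<comment> \<open>If \<open>m\<close> were zero, the densities would tend to zero and
        \<open>sum_not_geometric\<close> would contradict these lower bounds.\<close>
      then have "m \<noteq> 0" using sum_not_geometric[OF q(1), of S C] dens(1) not_less by metis
      then show "measure M (ray_words G A H T) > 0" by (simp add: m_def zero_less_measure_iff)
    next
      assume "measure M (ray_words G A H T) > 0"
      then have "m > 0" by (simp add: m_def)
      \<comment> \<open>The shift \<open>C\<close> compensates for the density:
        \<open>m * q ^ C > 1\<close>.\<close>
      obtain C where C: "1 / m < q ^ C" using real_arch_pow[of q] q by auto
      have "S (Suc k) \<le> (q + 1) * q ^ k" for k
        using dens(3)[of k] q by (simp add: divide_le_eq)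
      then have "(\<Sum>k\<le>n. S k) \<le> q ^ Suc n" for n
        using q by (intro sum_le_geometric) (simp_all add: S_def level_0)
      then have "real (growth G A H n) \<le> q ^ Suc n" for n using upper order_trans by blast
      then have "growth G A H n \<le> (2 * card A - 1) ^ (n + 1)" for n
        using q(3) by (metis Suc_eq_plus1 of_nat_le_iff of_nat_power)
      \<comment> \<open>One more step than \<open>C\<close> is taken because \<open>dens\<close>
        measures level \<open>Suc n\<close> against \<open>q ^ n\<close>.\<close>
      moreover have "(2 * card A - 1) ^ n \<le> growth G A H (n + Suc C)" for n
      proof -
        have "q ^ n * 1 \<le> q ^ n * (m * q ^ C)"
          using C \<open>m > 0\<close> q by (intro mult_left_mono) (auto simp: field_simps)
        also have "\<dots> = m * q ^ (n + C)" by (simp add: power_add)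
        also have "\<dots> \<le> m * ((q + 1) * q ^ (n + C))"
          using \<open>m > 0\<close> q by (intro mult_left_mono) (auto simp: algebra_simps)
        also have "\<dots> \<le> S (Suc (n + C))"
          using dens(2)[of "n + C"] q by (simp add: le_divide_eq)
        also have "\<dots> \<le> growth G A H (n + Suc C)" using lower[of "n + Suc C"] by simp
        finally show ?thesis using q(3) by (metis mult.right_neutral of_nat_le_iff of_nat_power)
      qed
      ultimately show "maximal_growth G A H"
        unfolding maximal_growth_def growth_equivalent_def by blast
    qed
  qed
  then show ?thesis by blast
qed

end
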